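(* Let $\delta \in ]0,1[$ be given. Then there exists a positive constant $C_{\delta}$ such that, for $\lambda$ large enough and for any nonzero eigenfunction $u$ of the isotropic two-dimensional quantum harmonic oscillator, $$\widehat{H} := - \Delta + |x|^2 \ \text{ on } L^2(\mathbb{R}^2,\mathbb{R}), \qquad \widehat{H} u = \lambda u,$$ the length of $N(u) \cap B\left( \sqrt{\delta \lambda} \right)$ is bounded from below by $C_{\delta}\, \lambda^{\frac{3}{2}}$.
   Context: $N(u)$ is the nodal set of $u$, i.e. the closure of the zero set $\{u=0\}$, and $B(r)$ is the open ball in $\mathbb{R}^2$ with center the origin and radius $r$. Length means one-dimensional Hausdorff measure. *)

theory Defs
  imports "HOL-Analysis.Analysis"
begin

definition partial_deriv :: "'n::finite \<Rightarrow> (real^'n \<Rightarrow> real) \<Rightarrow> real^'n \<Rightarrow> real" where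
  "partial_deriv i f x = frechet_derivative f (at x) (axis i 1)"

primrec Ck :: "nat \<Rightarrow> (real^'n::finite \<Rightarrow> real) \<Rightarrow> bool" where
  "Ck 0 f \<longleftrightarrow> continuous_on UNIV f"
| "Ck (Suc k) f \<longleftrightarrow> (\<forall>x. f differentiable (at x)) \<and> (\<forall>i. Ck k (partial_deriv i f))"

definition test_function :: "(real^'n::finite \<Rightarrow> real) \<Rightarrow> bool" where
  "test_function \<phi> \<longleftrightarrow> (\<forall>k. Ck k \<phi>) \<and> compact (closure {x. \<phi> x \<noteq> 0})"

definition laplacian :: "(real^'n::finite \<Rightarrow> real) \<Rightarrow> real^'n \<Rightarrow> real" where
  "laplacian f x = (\<Sum>i\<in>UNIV. partial_deriv i (partial_deriv i f) x)"

definition square_integrable :: "(real^'n::finite \<Rightarrow> real) \<Rightarrow> bool" where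
  "square_integrable u \<longleftrightarrow>
     u \<in> borel_measurable lebesgue \<and> integrable lebesgue (\<lambda>x. (u x)\<^sup>2)"

definition oscillator_expr :: "(real^2 \<Rightarrow> real) \<Rightarrow> real^2 \<Rightarrow> real" where
  "oscillator_expr \<phi> x = - laplacian \<phi> x + (norm x)\<^sup>2 * \<phi> x"

text \<open>
  The harmonic oscillator as an unbounded operator on \<open>L\<^sup>2\<close>, given by its graph
  \<open>oscillator u f\<close> (to be read as \<open>H u = f\<close>, for functions rather than their
  almost-everywhere classes). The expression \<open>- \<Delta> + |x|\<^sup>2\<close> acts in the sense of
  distributions, on the maximal domain of those \<open>u\<close> in \<open>L\<^sup>2\<close> whose image is again in \<open>L\<^sup>2\<close>.
  This is the adjoint of the expression on the compactly supported smooth functions; as that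
  operator is essentially self-adjoint, it is its unique self-adjoint extension.
\<close>

definition oscillator :: "(real^2 \<Rightarrow> real) \<Rightarrow> (real^2 \<Rightarrow> real) \<Rightarrow> bool" where
  "oscillator u f \<longleftrightarrow> square_integrable u \<and> square_integrable f \<and>
     (\<forall>\<phi>. test_function \<phi> \<longrightarrow>
        (LINT x|lebesgue. u x * oscillator_expr \<phi> x) = (LINT x|lebesgue. f x * \<phi> x))"

text \<open>
  Eigenfunctions are smooth after modification on a null set, and the nodal set is that of the
  continuous representative; hence the continuity requirement. No differentiability is
  required: the eigenvalue equation is the operator equation in \<open>L\<^sup>2\<close>.
\<close>

definition oscillator_eigenfunction :: "real \<Rightarrow> (real^2 \<Rightarrow> real) \<Rightarrow> bool" where
  "oscillator_eigenfunction lam u \<longleftrightarrow>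
     continuous_on UNIV u \<and> \<not> (AE x in lebesgue. u x = 0) \<and> oscillator u (\<lambda>x. lam * u x)"

definition nodal_set :: "(real^2 \<Rightarrow> real) \<Rightarrow> (real^2) set" where
  "nodal_set u = closure {x. u x = 0}"

text \<open>
  One-dimensional Hausdorff (outer) measure, normalised so that a segment has its usual length.
  Covering sets must be bounded since \<open>diameter\<close> is meaningless for unbounded sets; finite
  covers are included because \<open>diameter {} = 0\<close>.
\<close>

definition hausdorff_pre :: "real \<Rightarrow> 'a::metric_space set \<Rightarrow> ennreal" where
  "hausdorff_pre d A =
     (INF U \<in> {U :: nat \<Rightarrow> 'a set. A \<subseteq> (\<Union>k. U k) \<and>
                 (\<forall>k. bounded (U k) \<and> diameter (U k) \<le> d)}.
        \<Sum>k. ennreal (diameter (U k)))"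

definition hausdorff_length :: "'a::metric_space set \<Rightarrow> ennreal" where
  "hausdorff_length A = (SUP d \<in> {0<..}. hausdorff_pre d A)"

end

theory Submission
  imports Defs
begin

text \<open>
  Put \<open>r = \<lambda>\<^bsup>-1/2\<^esup>\<close>. Two facts about the weak equation \<open>\<Delta>u + (\<lambda> - |x|\<^sup>2)u = 0\<close> suffice.

  \<^item> A square in \<open>B(\<surd>(\<delta>\<lambda>))\<close> of side a suitable multiple of \<open>r\<close> contains a zero: it carries a bump
    \<open>\<phi> \<ge> 0\<close> with \<open>\<Delta>\<phi> + (\<lambda> - |x|\<^sup>2)\<phi> \<ge> 0\<close>, and testing with \<open>\<phi>\<close> excludes a constant sign of \<open>u\<close>.
  \<^item> If \<open>u(c) = 0\<close>, every circle of radius \<open>t < r\<close> around \<open>c\<close> contains a zero: were \<open>u > 0\<close> on the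
    circle with minimum \<open>-m \<le> 0\<close> inside, then \<open>\<Delta>u \<le> \<lambda>m\<close> in the disc, so the superharmonic function
    \<open>u - \<lambda>m|x - c|\<^sup>2/4\<close> would violate the minimum principle. This is made precise by mollification.

  As the distance to \<open>c\<close> is 1-Lipschitz, the nodal set has length at least \<open>r\<close> in the disc of
  radius \<open>r\<close> around \<open>c\<close>, and there are about \<open>\<lambda>\<^sup>2\<close> separated discs of this kind.
\<close>

section \<open>Bump functions\<close>

text \<open>The powers of \<open>1/x\<close> make the family closed under differentiation up to
  linear combinations, so that smoothness follows by induction.\<close>

definition flat :: "nat \<Rightarrow> real \<Rightarrow> real" where
  "flat n x = (if x > 0 then exp (- (1/x)) / x ^ n else 0)"

text \<open>As \<open>flat n 0 = 0\<close>, this is the difference quotient at 0. From the right,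
  \<open>y = 1/h\<close> turns it into \<open>y ^ Suc n / exp y\<close>.\<close>

lemma flat_div_tendsto_0: "((\<lambda>h. flat n h / h) \<longlongrightarrow> 0) (at 0)"
proof -
  have "((\<lambda>h. (1/h) ^ Suc n / exp (1/h)) \<longlongrightarrow> 0) (at_right (0::real))"
    using filterlim_compose[OF tendsto_power_div_exp_0[of "Suc n"] filterlim_inverse_at_top_right]
    by (simp only: inverse_eq_divide)
  then have R: "((\<lambda>h. flat n h / h) \<longlongrightarrow> 0) (at_right 0)"
    by (rule Lim_transform_eventually)
       (auto simp: flat_def exp_minus field_simps eventually_at_right_less
             intro!: eventually_mono[OF eventually_at_right_less])
  have L: "((\<lambda>h. flat n h / h) \<longlongrightarrow> 0) (at_left 0)"
    by (rule Lim_transform_eventually[OF tendsto_const])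
       (auto simp: flat_def eventually_at intro!: exI[of _ 1])
  show ?thesis
    using L R by (rule filterlim_split_at)
qed

lemma flat_has_real_derivative:
  "(flat n has_real_derivative flat (n + 2) x - n * flat (n + 1) x) (at x)"
proof (cases x "0::real" rule: linorder_cases)
  case less
  have "(flat n has_real_derivative 0) (at x)"
    by (rule has_field_derivative_transform_within_open[OF DERIV_const, of "{..<0}" _ 0])
       (use less in \<open>auto simp: flat_def\<close>)
  with less show ?thesis by (simp add: flat_def)
next
  case equal
  then show ?thesis
    using flat_div_tendsto_0[of n] by (simp add: DERIV_def) (simp add: flat_def)
next
  case greater
  have "((\<lambda>x. exp (- (1/x)) / x ^ n) has_real_derivative
      exp (- (1/x)) / x ^ (n + 2) - n * (exp (- (1/x)) / x ^ (n + 1))) (at x)"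
  \<comment> \<open>Splitting off \<open>n = 0\<close> avoids the exponent
    \<open>n - 1\<close>.\<close>
  proof (cases n)
    case 0
    then show ?thesis
      using greater by (auto intro!: derivative_eq_intros simp: power2_eq_square)
  next
    case (Suc m)
    have "((\<lambda>x. exp (- (1/x)) / x ^ Suc m) has_real_derivative
        (exp (- (1/x)) * (1 / x\<^sup>2) * x ^ Suc m - exp (- (1/x)) * (Suc m * x ^ m)) / (x ^ Suc m * x ^ Suc m)) (at x)"
      using greater by (auto intro!: derivative_eq_intros simp: power2_eq_square simp del: power_Suc)
    moreover have "(exp (- (1/x)) * (1 / x\<^sup>2) * x ^ Suc m - exp (- (1/x)) * (Suc m * x ^ m)) / (x ^ Suc m * x ^ Suc m)
      = exp (- (1/x)) / x ^ (Suc m + 2) - Suc m * (exp (- (1/x)) / x ^ (Suc m + 1))"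
      using greater by (simp add: diff_divide_distrib power2_eq_square)
    ultimately show ?thesis using Suc by simp
  qed
  then have "(flat n has_real_derivative
      exp (- (1/x)) / x ^ (n + 2) - n * (exp (- (1/x)) / x ^ (n + 1))) (at x)"
    by (rule has_field_derivative_transform_within_open[of _ _ _ "{0<..}"])
       (use greater in \<open>auto simp: flat_def\<close>)
  with greater show ?thesis by (simp add: flat_def)
qed

lemma flat_nonneg: "0 \<le> flat n x"
  by (simp add: flat_def)

text \<open>On the open interval from -1 to 1 this is exp(-2/(1 - x^2)). The factored form reduces
  smoothness to that of \<open>flat\<close> at affine arguments.\<close>

definition bump :: "real \<Rightarrow> real" where
  "bump x = flat 0 (1 + x) * flat 0 (1 - x)"

definition bump' :: "real \<Rightarrow> real" where
  "bump' x = flat 2 (1 + x) * flat 0 (1 - x) - flat 0 (1 + x) * flat 2 (1 - x)"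

definition bump'' :: "real \<Rightarrow> real" where
  "bump'' x = (flat 4 (1 + x) - 2 * flat 3 (1 + x)) * flat 0 (1 - x)
     - 2 * flat 2 (1 + x) * flat 2 (1 - x)
     + flat 0 (1 + x) * (flat 4 (1 - x) - 2 * flat 3 (1 - x))"

lemma flat_compose_has_real_derivative [derivative_intros]:
  assumes "(g has_real_derivative D) (at x)"
  shows "((\<lambda>x. flat n (g x)) has_real_derivative (flat (n + 2) (g x) - n * flat (n + 1) (g x)) * D) (at x)"
  using DERIV_chain2[OF flat_has_real_derivative assms] .

lemma bump_has_real_derivative: "(bump has_real_derivative bump' x) (at x)"
  unfolding bump_def[abs_def] bump'_def
  by (auto intro!: derivative_eq_intros simp: numeral_2_eq_2)

lemma bump'_has_real_derivative: "(bump' has_real_derivative bump'' x) (at x)"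
  unfolding bump'_def[abs_def] bump''_def
  by (auto intro!: derivative_eq_intros simp: eval_nat_numeral algebra_simps)

lemma continuous_on_flat [continuous_intros]:
  "continuous_on S g \<Longrightarrow> continuous_on S (\<lambda>x. flat n (g x))"
  by (rule continuous_on_compose2[of UNIV "flat n"])
     (auto intro: DERIV_continuous_on DERIV_subset flat_has_real_derivative)

lemma continuous_on_bump [continuous_intros]:
  "continuous_on S g \<Longrightarrow> continuous_on S (\<lambda>x. bump (g x))"
  "continuous_on S g \<Longrightarrow> continuous_on S (\<lambda>x. bump' (g x))"
  "continuous_on S g \<Longrightarrow> continuous_on S (\<lambda>x. bump'' (g x))"
  by (simp_all add: bump_def bump'_def bump''_def continuous_intros)

lemma bump_nonneg: "0 \<le> bump x"
  by (simp add: bump_def flat_nonneg)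

lemma bump_pos_iff: "0 < bump x \<longleftrightarrow> \<bar>x\<bar> < 1"
  by (auto simp: bump_def flat_def zero_less_mult_iff)

lemma bump_eq_0: "1 \<le> \<bar>x\<bar> \<Longrightarrow> bump x = 0" "1 \<le> \<bar>x\<bar> \<Longrightarrow> bump'' x = 0"
  by (auto simp: bump_def bump''_def flat_def)

text \<open>The quotient \<open>bump'' / bump\<close> is a polynomial in
  \<open>P = 1/(1 - x^2)\<close>, and it is bounded below even though \<open>P\<close> blows up at
  the endpoints. This makes suitably scaled bumps subsolutions of the oscillator equation.\<close>

lemma bump''_ge: "bump'' x \<ge> - 9 * bump x"
proof (cases "\<bar>x\<bar> < 1")
  case True
  define p where "p = 1 / (1 + x)"
  define q where "q = 1 / (1 - x)"
  define P where "P = p * q"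
  have pq: "p + q = 2 * P" "p > 0" "q > 0"
    using True by (auto simp: P_def p_def q_def field_simps)
  have P: "1 \<le> P"
    unfolding P_def p_def q_def using True
    by (simp add: field_simps abs_square_less_1 flip: power2_eq_square)
  \<comment> \<open>\<open>bump = exp (- p - q)\<close> with \<open>p' = - p\<^sup>2\<close> and \<open>q' = q\<^sup>2\<close>\<close>
  have "bump'' x = bump x * (p^4 - 2*p^3 - 2*p^2*q^2 + q^4 - 2*q^3)"
  proof -
    have "flat n (1 + x) = exp (- p) * p ^ n" "flat n (1 - x) = exp (- q) * q ^ n" for n
      using True by (auto simp: flat_def p_def q_def power_divide)
    then show ?thesis
      unfolding bump_def bump''_def by (simp add: algebra_simps)
  qed
  also have "p^4 - 2*p^3 - 2*p^2*q^2 + q^4 - 2*q^3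
      = (p+q)^2 * ((p+q)^2 - 4*(p*q)) - 2*((p+q)^3 - 3*(p*q)*(p+q))"
    by algebra
  also have "\<dots> = 4 * P^2 * ((2*P-2)^2 - 1)"
    unfolding pq(1) P_def[symmetric] by algebra
  finally have eq: "bump'' x = bump x * (4 * P^2 * ((2*P-2)^2 - 1))" .
  \<comment> \<open>The bracket is at least -1, and nonnegative once \<open>P\<close> reaches 3/2.
    Below 3/2 the prefactor is at most 9, hence the constant.\<close>
  have "4 * P^2 * ((2*P-2)^2 - 1) \<ge> -9"
  proof (cases "P \<ge> 3/2")
    case True
    then have "(2*P-2)^2 \<ge> 1" by (intro one_le_power) auto
    then have "4 * P^2 * ((2*P-2)^2 - 1) \<ge> 0" by simp
    then show ?thesis by simp
  next
    case False
    then have "P^2 \<le> (3/2)^2" using P by (intro power_mono) auto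
    then have *: "4 * P^2 \<le> 9" by (simp add: power2_eq_square)
    have "4 * P^2 * ((2*P-2)^2 - 1) \<ge> 4 * P^2 * (-1)"
      by (intro mult_left_mono) auto
    with * show ?thesis by simp
  qed
  then have "bump x * (4 * P^2 * ((2*P-2)^2 - 1)) \<ge> bump x * (-9)"
    by (intro mult_left_mono bump_nonneg)
  then show ?thesis using eq by simp
next
  case False
  then show ?thesis by (simp add: bump_eq_0)
qed

section \<open>Smoothness of sums, products and coordinate bumps\<close>

lemma partial_deriv_eq:
  "(f has_derivative f') (at x) \<Longrightarrow> partial_deriv i f x = f' (axis i 1)"
  unfolding partial_deriv_def using frechet_derivative_at by metis

text \<open>Needed for the product rule, whose terms also contain the undifferentiated
  factors.\<close>

lemma Ck_Suc_imp: "Ck (Suc k) f \<Longrightarrow> Ck k f"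
proof (induction k arbitrary: f)
  case 0
  then show ?case
    by (auto intro!: continuous_at_imp_continuous_on differentiable_imp_continuous_within)
qed simp

lemma Ck_const: "Ck k (\<lambda>x::real^'n::finite. c)"
proof (induction k arbitrary: c)
  case (Suc k)
  have "partial_deriv i (\<lambda>x::real^'n. c) = (\<lambda>x. 0)" for i :: 'n and c
    by (auto simp: fun_eq_iff partial_deriv_eq[OF has_derivative_const])
  with Suc show ?case by simp
qed (simp add: continuous_intros)

lemma Ck_add: "Ck k f \<Longrightarrow> Ck k g \<Longrightarrow> Ck k (\<lambda>x. f x + g x)"
proof (induction k arbitrary: f g)
  case (Suc k)
  have "partial_deriv i (\<lambda>x. f x + g x) = (\<lambda>x. partial_deriv i f x + partial_deriv i g x)" for i
    using Suc.prems unfolding fun_eq_iff Ck.simps frechet_derivative_works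
    by (auto simp: partial_deriv_def[of i f] partial_deriv_def[of i g]
        intro!: partial_deriv_eq[THEN trans] has_derivative_add)
  with Suc show ?case by simp
qed (simp add: continuous_intros)

lemma Ck_mult: "Ck k f \<Longrightarrow> Ck k g \<Longrightarrow> Ck k (\<lambda>x. f x * g x)"
proof (induction k arbitrary: f g)
  case (Suc k)
  have "partial_deriv i (\<lambda>x. f x * g x)
      = (\<lambda>x. f x * partial_deriv i g x + partial_deriv i f x * g x)" for i
    using Suc.prems unfolding fun_eq_iff Ck.simps frechet_derivative_works
    by (auto simp: partial_deriv_def[of i f] partial_deriv_def[of i g]
        intro!: partial_deriv_eq[THEN trans] has_derivative_mult)
  moreover have "Ck k f" "Ck k g" using Suc.prems by (auto intro: Ck_Suc_imp)
  ultimately show ?case using Suc by (simp add: Ck_add)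
qed (simp add: continuous_intros)

lemma has_derivative_coordinate:
  fixes g :: "real \<Rightarrow> real"
  assumes "\<And>z. (g has_real_derivative g' z) (at z)"
  shows "((\<lambda>x::real^'n. g (x $ i)) has_derivative (\<lambda>h. g' (x $ i) * h $ i)) (at x)"
  using has_derivative_compose[OF bounded_linear_imp_has_derivative[OF bounded_linear_vec_nth]
      assms[unfolded has_field_derivative_def]] .

text \<open>Each differentiation yields \<open>flat\<close> with larger index at the same affine
  argument, so the induction on \<open>k\<close> runs over all \<open>n\<close>. The affine argument
  covers scaling, translation and reflection.\<close>

lemma Ck_flat: "Ck k (\<lambda>x::real^'n::finite. flat n (\<alpha> * x $ i + \<beta>))"
proof (induction k arbitrary: n)
  case 0
  show ?case by (simp add: continuous_intros)
next
  case (Suc k)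
  have d: "((\<lambda>x::real^'n. flat n (\<alpha> * x $ i + \<beta>)) has_derivative
     (\<lambda>h. (flat (n + 2) (\<alpha> * x $ i + \<beta>) - n * flat (n + 1) (\<alpha> * x $ i + \<beta>)) * \<alpha> * h $ i)) (at x)" for x
    by (rule has_derivative_coordinate) (auto intro!: derivative_eq_intros)
  have "partial_deriv j (\<lambda>x. flat n (\<alpha> * x $ i + \<beta>)) =
    (\<lambda>x. (if i = j then \<alpha> else 0) * (flat (n + 2) (\<alpha> * x $ i + \<beta>)
          + (- real n) * flat (n + 1) (\<alpha> * x $ i + \<beta>)))" for j
    by (auto simp: fun_eq_iff partial_deriv_eq[OF d] axis_def)
  moreover have "Ck k (\<lambda>x::real^'n. (if i = j then \<alpha> else 0) * (flat (n + 2) (\<alpha> * x $ i + \<beta>)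
          + (- real n) * flat (n + 1) (\<alpha> * x $ i + \<beta>)))" for j
    by (intro Ck_mult Ck_add Ck_const Suc)
  ultimately show ?case
    using d by (auto simp only: Ck.simps differentiable_def)
qed

section \<open>Zeros in small squares\<close>

definition square :: "real^2 \<Rightarrow> real \<Rightarrow> (real^2) set" where
  "square p s = cbox (p - vec s) (p + vec s)"

lemma mem_square_iff: "x \<in> square p s \<longleftrightarrow> \<bar>x$1 - p$1\<bar> \<le> s \<and> \<bar>x$2 - p$2\<bar> \<le> s"
  by (auto simp: square_def mem_box_cart forall_2 abs_le_iff)

definition square_bump :: "real^2 \<Rightarrow> real \<Rightarrow> real^2 \<Rightarrow> real" where
  "square_bump p s x = bump ((x$1 - p$1) / s) * bump ((x$2 - p$2) / s)"

definition square_bump_lap :: "real^2 \<Rightarrow> real \<Rightarrow> real^2 \<Rightarrow> real" where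
  "square_bump_lap p s x = (bump'' ((x$1 - p$1) / s) * bump ((x$2 - p$2) / s)
     + bump ((x$1 - p$1) / s) * bump'' ((x$2 - p$2) / s)) / s\<^sup>2"

lemma continuous_on_square_bump [continuous_intros]:
  "continuous_on S g \<Longrightarrow> continuous_on S (\<lambda>x. square_bump p s (g x))"
  "continuous_on S g \<Longrightarrow> continuous_on S (\<lambda>x. square_bump_lap p s (g x))"
  by (simp_all add: square_bump_def square_bump_lap_def divide_inverse continuous_intros)

lemma square_bump_nonneg: "0 \<le> square_bump p s x"
  by (simp add: square_bump_def bump_nonneg)

lemma square_bump_pos: "s > 0 \<Longrightarrow> 0 < square_bump p s p"
  by (simp add: square_bump_def bump_pos_iff)

lemma square_bump_eq_0:
  assumes "s > 0" "x \<notin> square p s"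
  shows "square_bump p s x = 0" "square_bump_lap p s x = 0"
proof -
  have "1 \<le> \<bar>(x$1 - p$1) / s\<bar> \<or> 1 \<le> \<bar>(x$2 - p$2) / s\<bar>"
    using assms by (auto simp: mem_square_iff abs_divide)
  then show "square_bump p s x = 0" "square_bump_lap p s x = 0"
    by (auto simp: square_bump_def square_bump_lap_def bump_eq_0)
qed

text \<open>Each of the two coordinates contributes 9 by \<open>bump''_ge\<close>; scaling by
  \<open>s\<close> divides by \<open>s\<^sup>2\<close>.\<close>

lemma square_bump_lap_ge: "square_bump_lap p s x \<ge> - (18 / s\<^sup>2) * square_bump p s x"
proof -
  let ?a = "(x$1 - p$1) / s" and ?b = "(x$2 - p$2) / s"
  have "bump'' ?a * bump ?b \<ge> (- 9 * bump ?a) * bump ?b"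
    by (intro mult_right_mono bump''_ge bump_nonneg)
  moreover have "bump ?a * bump'' ?b \<ge> bump ?a * (- 9 * bump ?b)"
    by (intro mult_left_mono bump''_ge bump_nonneg)
  ultimately have "(bump'' ?a * bump ?b + bump ?a * bump'' ?b) / s\<^sup>2
      \<ge> (- 18 * (bump ?a * bump ?b)) / s\<^sup>2"
    by (intro divide_right_mono) auto
  then show ?thesis by (simp add: square_bump_lap_def square_bump_def)
qed

lemma partial_deriv_prod:
  fixes i :: 2 and g h :: "real \<Rightarrow> real"
  assumes "\<And>z. (g has_real_derivative g' z) (at z)" "\<And>z. (h has_real_derivative h' z) (at z)"
  shows "partial_deriv i (\<lambda>x. g (x$1) * h (x$2))
     = (\<lambda>x. if i = 1 then g' (x$1) * h (x$2) else g (x$1) * h' (x$2))"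
proof
  fix x :: "real^2"
  show "partial_deriv i (\<lambda>x. g (x$1) * h (x$2)) x
     = (if i = 1 then g' (x$1) * h (x$2) else g (x$1) * h' (x$2))"
    using exhaust_2[of i]
    by (subst partial_deriv_eq[OF has_derivative_mult[OF
          has_derivative_coordinate[OF assms(1)] has_derivative_coordinate[OF assms(2)]]])
       (auto simp: axis_def)
qed

lemma bump_scaled_has_real_derivative:
  "((\<lambda>z. bump ((z - c) / s)) has_real_derivative bump' ((z - c) / s) / s) (at z)"
  "((\<lambda>z. bump' ((z - c) / s) / s) has_real_derivative bump'' ((z - c) / s) / s\<^sup>2) (at z)"
proof -
  have d: "((\<lambda>z. (z - c) / s) has_real_derivative 1 / s) (at z)"
    by (rule DERIV_cdivide) (auto intro!: derivative_eq_intros)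
  show "((\<lambda>z. bump ((z - c) / s)) has_real_derivative bump' ((z - c) / s) / s) (at z)"
    using DERIV_chain2[OF bump_has_real_derivative d] by simp
  show "((\<lambda>z. bump' ((z - c) / s) / s) has_real_derivative bump'' ((z - c) / s) / s\<^sup>2) (at z)"
    using DERIV_cdivide[OF DERIV_chain2[OF bump'_has_real_derivative d], of s]
    by (simp add: power2_eq_square)
qed

lemma laplacian_square_bump: "laplacian (square_bump p s) x = square_bump_lap p s x"
proof -
  note d = bump_scaled_has_real_derivative
  have "partial_deriv 1 (square_bump p s) = (\<lambda>x. bump' ((x$1 - p$1) / s) / s * bump ((x$2 - p$2) / s))"
    "partial_deriv 2 (square_bump p s) = (\<lambda>x. bump ((x$1 - p$1) / s) * (bump' ((x$2 - p$2) / s) / s))"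
    using partial_deriv_prod[OF d(1)[of "p$1" s] d(1)[of "p$2" s]]
    by (simp_all add: square_bump_def[abs_def])
  moreover have "partial_deriv 1 (\<lambda>x. bump' ((x$1 - p$1) / s) / s * bump ((x$2 - p$2) / s)) x
      = bump'' ((x$1 - p$1) / s) / s\<^sup>2 * bump ((x$2 - p$2) / s)"
    using partial_deriv_prod[OF d(2)[of "p$1" s] d(1)[of "p$2" s]] by simp
  moreover have "partial_deriv 2 (\<lambda>x. bump ((x$1 - p$1) / s) * (bump' ((x$2 - p$2) / s) / s)) x
      = bump ((x$1 - p$1) / s) * (bump'' ((x$2 - p$2) / s) / s\<^sup>2)"
    using partial_deriv_prod[OF d(1)[of "p$1" s] d(2)[of "p$2" s]] by simp
  ultimately show ?thesis
    by (simp add: laplacian_def sum_2 square_bump_lap_def add_divide_distrib)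
qed

lemma test_function_square_bump:
  assumes "s > 0" shows "test_function (square_bump p s)"
proof -
  \<comment> \<open>Four factors \<open>flat\<close> at affine arguments of single coordinates, the
    form covered by \<open>Ck_flat\<close>.\<close>
  have "square_bump p s = (\<lambda>x.
      (flat 0 (1/s * x$1 + (1 - p$1/s)) * flat 0 ((-1/s) * x$1 + (1 + p$1/s)))
    * (flat 0 (1/s * x$2 + (1 - p$2/s)) * flat 0 ((-1/s) * x$2 + (1 + p$2/s))))"
    by (simp add: fun_eq_iff square_bump_def bump_def diff_divide_distrib algebra_simps)
  then have "Ck k (square_bump p s)" for k
    by (simp only:) (intro Ck_mult Ck_flat)
  moreover have "{x. square_bump p s x \<noteq> 0} \<subseteq> square p s"
    using square_bump_eq_0(1)[OF assms] by auto
  then have "bounded {x. square_bump p s x \<noteq> 0}"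
    unfolding square_def by (rule bounded_subset[OF bounded_cbox])
  ultimately show ?thesis by (simp add: test_function_def compact_closure)
qed

section \<open>From the operator equation to integrals over boxes\<close>

lemma LINT_eq_integral_cbox:
  fixes g :: "'a::euclidean_space \<Rightarrow> real"
  assumes "continuous_on UNIV g" and "\<And>x. x \<notin> cbox a b \<Longrightarrow> g x = 0"
  shows "(LINT x|lebesgue. g x) = integral (cbox a b) g"
proof -
  have "g absolutely_integrable_on cbox a b"
    using assms(1) by (intro absolutely_integrable_continuous) (rule continuous_on_subset, auto)
  then have "(LINT x:cbox a b|lebesgue. g x) = integral (cbox a b) g"
    by (rule set_lebesgue_integral_eq_integral(2))
  moreover have "(LINT x:cbox a b|lebesgue. g x) = (LINT x|lebesgue. g x)"
    unfolding set_lebesgue_integral_def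
    by (intro Bochner_Integration.integral_cong) (use assms(2) in \<open>auto simp: indicator_def\<close>)
  ultimately show ?thesis by simp
qed

text \<open>The box is any box containing the support, so that the equation applies with a box
  independent of the bump.\<close>

definition weak_solution :: "real \<Rightarrow> (real^2 \<Rightarrow> real) \<Rightarrow> bool" where
  "weak_solution lam u \<longleftrightarrow> continuous_on UNIV u \<and>
     (\<forall>p s a b. s > 0 \<longrightarrow> square p s \<subseteq> cbox a b \<longrightarrow>
        integral (cbox a b) (\<lambda>x. u x *
          (square_bump_lap p s x + (lam - (norm x)\<^sup>2) * square_bump p s x)) = 0)"

lemma weak_solution_uminus: "weak_solution lam u \<Longrightarrow> weak_solution lam (\<lambda>x. - u x)"
  by (auto simp: weak_solution_def continuous_intros)

text \<open>A square bump is an admissible test function. All integrands are continuous and vanish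
  off the box, so the Lebesgue integrals become box integrals that can be subtracted.\<close>

lemma weak_solution_eigenfunction:
  assumes "oscillator_eigenfunction lam u"
  shows "weak_solution lam u"
  unfolding weak_solution_def
proof (intro conjI allI impI)
  show cont: "continuous_on UNIV u"
    using assms by (simp add: oscillator_eigenfunction_def)
  fix p s and a b :: "real^2" assume s: "s > 0" and sub: "square p s \<subseteq> cbox a b"
  let ?f = "\<lambda>x. u x * oscillator_expr (square_bump p s) x"
  let ?g = "\<lambda>x. lam * u x * square_bump p s x"
  have eq: "(LINT x|lebesgue. ?f x) = (LINT x|lebesgue. ?g x)"
    using assms test_function_square_bump[OF s, of p]
    by (auto simp: oscillator_eigenfunction_def oscillator_def)
  have cf: "continuous_on UNIV ?f" and cg: "continuous_on UNIV ?g"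
    using cont unfolding oscillator_expr_def laplacian_square_bump
    by (auto intro!: continuous_intros)
  have "square_bump p s x = 0" "square_bump_lap p s x = 0" if "x \<notin> cbox a b" for x
    using square_bump_eq_0[OF s] sub that by blast+
  then have "integral (cbox a b) ?f = integral (cbox a b) ?g"
    using eq LINT_eq_integral_cbox[OF cf, of a b] LINT_eq_integral_cbox[OF cg, of a b]
    by (simp add: oscillator_expr_def laplacian_square_bump)
  moreover have "integral (cbox a b) (\<lambda>x. ?g x - ?f x) = integral (cbox a b) ?g - integral (cbox a b) ?f"
    using cf cg by (intro integral_diff integrable_continuous) (auto intro: continuous_on_subset)
  moreover have "(\<lambda>x. ?g x - ?f x) = (\<lambda>x. u x *
          (square_bump_lap p s x + (lam - (norm x)\<^sup>2) * square_bump p s x))"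
    by (simp add: fun_eq_iff oscillator_expr_def laplacian_square_bump algebra_simps)
  ultimately show "integral (cbox a b) (\<lambda>x. u x *
          (square_bump_lap p s x + (lam - (norm x)\<^sup>2) * square_bump p s x)) = 0"
    by simp
qed

text \<open>By \<open>square_bump_lap_ge\<close> the factor of \<open>u\<close> in the weak equation
  is at least a positive multiple of the bump on the square. For positive \<open>u\<close> the
  integrand would be nonnegative, and positive at \<open>p\<close>, while its integral is 0.\<close>

lemma weak_solution_not_pos:
  assumes u: "weak_solution lam u" and s: "s > 0"
    and V: "\<And>x. x \<in> square p s \<Longrightarrow> 18 / s\<^sup>2 < lam - (norm x)\<^sup>2"
  shows "\<not> (\<forall>x\<in>square p s. 0 < u x)"
proof
  assume pos: "\<forall>x\<in>square p s. 0 < u x"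
  let ?F = "\<lambda>x. square_bump_lap p s x + (lam - (norm x)\<^sup>2) * square_bump p s x"
  have ge: "?F x \<ge> (lam - (norm x)\<^sup>2 - 18 / s\<^sup>2) * square_bump p s x" for x
    using square_bump_lap_ge[of s p x] by (simp add: algebra_simps)
  have nonneg: "0 \<le> u x * ?F x" if "x \<in> cbox (p - vec s) (p + vec s)" for x
  proof -
    have x: "x \<in> square p s" using that by (simp add: square_def)
    then have "0 \<le> (lam - (norm x)\<^sup>2 - 18 / s\<^sup>2) * square_bump p s x"
      using V[OF x] by (intro mult_nonneg_nonneg square_bump_nonneg) auto
    then show ?thesis using pos x ge[of x] by (intro mult_nonneg_nonneg) auto
  qed
  have "integral (cbox (p - vec s) (p + vec s)) (\<lambda>x. u x * ?F x) = 0"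
    using u s unfolding weak_solution_def square_def by blast
  moreover have "continuous_on (cbox (p - vec s) (p + vec s)) (\<lambda>x. u x * ?F x)"
    using u unfolding weak_solution_def
    by (auto intro!: continuous_intros intro: continuous_on_subset)
  moreover have "box (p - vec s) (p + vec s) \<noteq> {}"
    using s by (auto simp: box_ne_empty inner_axis Basis_vec_def algebra_simps)
  moreover have p: "p \<in> cbox (p - vec s) (p + vec s)" "p \<in> square p s"
    using s by (auto simp: mem_box_cart mem_square_iff)
  ultimately have "u p * ?F p = 0"
    using integral_cbox_eq_0_iff[of "p - vec s" "p + vec s" "\<lambda>x. u x * ?F x"] nonneg by blast
  moreover have "0 < (lam - (norm p)\<^sup>2 - 18 / s\<^sup>2) * square_bump p s p"
    using V[OF p(2)] square_bump_pos[OF s] by (intro mult_pos_pos) auto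
  then have "0 < u p * ?F p"
    using pos p(2) ge[of p] by (intro mult_pos_pos) auto
  ultimately show False by linarith
qed

lemma connected_nonzero_sign:
  fixes u :: "'a::topological_space \<Rightarrow> real"
  assumes "connected S" "continuous_on S u" "\<forall>x\<in>S. u x \<noteq> 0"
  shows "(\<forall>x\<in>S. 0 < u x) \<or> (\<forall>x\<in>S. u x < 0)"
proof (rule ccontr)
  assume "\<not> ?thesis"
  then obtain x y where xy: "x \<in> S" "y \<in> S" "u x \<le> 0" "0 \<le> u y" by (auto simp: not_less)
  have "connected (u ` S)" using assms by (intro connected_continuous_image)
  then have "0 \<in> u ` S" using xy connectedD_interval by (meson imageI)
  then show False using assms(3) by auto
qed

lemma weak_solution_zero_in_square:
  assumes u: "weak_solution lam u" and s: "s > 0"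
    and V: "\<And>x. x \<in> square p s \<Longrightarrow> 18 / s\<^sup>2 < lam - (norm x)\<^sup>2"
  obtains c where "c \<in> square p s" "u c = 0"
proof -
  have "connected (square p s)"
    unfolding square_def by (intro convex_connected convex_box)
  moreover have "continuous_on (square p s) u"
    using u by (auto simp: weak_solution_def intro: continuous_on_subset)
  moreover have "\<not> (\<forall>x\<in>square p s. u x < 0)"
    using weak_solution_not_pos[OF weak_solution_uminus[OF u] s V] by simp
  ultimately show thesis
    using weak_solution_not_pos[OF u s V] connected_nonzero_sign that by metis
qed

section \<open>Zeros on small circles\<close>

text \<open>At the minimum \<open>F' 0 = 0\<close>. If \<open>D < 0\<close>, then \<open>F'\<close>
  is negative just to the right of 0, and the mean value theorem gives a smaller value of
  \<open>F\<close> there.\<close>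

lemma second_derivative_test_min:
  fixes F :: "real \<Rightarrow> real"
  assumes F: "\<And>s. (F has_real_derivative F' s) (at s)"
    and F': "(F' has_real_derivative D) (at 0)"
    and r: "0 < r" and min: "\<And>s. \<bar>s\<bar> < r \<Longrightarrow> F 0 \<le> F s"
  shows "0 \<le> D"
proof (rule ccontr)
  assume "\<not> 0 \<le> D"
  have F'0: "F' 0 = 0"
    by (rule DERIV_local_min[OF F r]) (use min in auto)
  obtain d where d: "d > 0" "\<And>h. 0 < h \<Longrightarrow> h < d \<Longrightarrow> F' h < 0"
    using DERIV_neg_dec_right[OF F'] \<open>\<not> 0 \<le> D\<close> F'0 by auto
  define h where "h = min r d / 2"
  have h: "0 < h" "h < r" "h < d" using r d(1) by (auto simp: h_def)
  obtain z where z: "0 < z" "z < h" "F h - F 0 = (h - 0) * F' z"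
    using MVT2[OF h(1), of F F'] F by blast
  have "F h - F 0 < 0"
    unfolding z(3) using h z d(2)[of z] by (simp add: mult_pos_neg)
  with min[of h] h show False by simp
qed

text \<open>The shift sits in the kernel \<open>G\<close>, so differentiation under the integral
  asks only for continuity of \<open>w\<close>.\<close>

lemma convolution_has_real_derivative:
  fixes w :: "real^'n::finite \<Rightarrow> real"
  assumes w: "continuous_on UNIV w"
    and G: "\<And>z. (G has_real_derivative G' z) (at z)" and G': "continuous_on UNIV G'"
  shows "((\<lambda>s. integral (cbox a b) (\<lambda>x. w x * G (x$i - s))) has_real_derivative
           integral (cbox a b) (\<lambda>x. w x * - G' (x$i - s))) (at s)"
proof (rule leibniz_rule_field_derivative[where U = UNIV, simplified])
  have contG: "continuous_on UNIV G"
    using G by (meson DERIV_continuous_on DERIV_subset top_greatest)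
  fix s x
  show "((\<lambda>s. w x * G (x$i - s)) has_real_derivative w x * - G' (x$i - s)) (at s)"
  proof -
    have "((\<lambda>s. x$i - s) has_real_derivative -1) (at s)"
      by (auto intro!: derivative_eq_intros)
    from DERIV_cmult[OF DERIV_chain2[OF G this], of "w x"] show ?thesis by simp
  qed
  show "(\<lambda>x. w x * G (x$i - s)) integrable_on cbox a b"
    by (intro integrable_continuous continuous_intros continuous_on_compose2[OF contG]
        continuous_on_subset[OF w]) auto
next
  show "continuous_on (UNIV \<times> cbox a b) (\<lambda>(s, x). w x * - G' (x$i - s))"
    unfolding split_beta
    by (intro continuous_intros continuous_on_compose2[OF G'] continuous_on_compose2[OF w]) auto
qed

text \<open>The term \<open>k * (2 * \<beta> * s + s\<^sup>2)\<close> is the increment of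
  \<open>k\<close> times a squared distance when one coordinate, at offset \<open>\<beta>\<close>
  from the centre, moves by \<open>s\<close>. Its second derivative is \<open>2 * k\<close>.\<close>

lemma convolution_second_derivative_test:
  fixes w :: "real^'n::finite \<Rightarrow> real"
  assumes w: "continuous_on UNIV w"
    and G: "\<And>z. (G has_real_derivative G' z) (at z)" and G': "\<And>z. (G' has_real_derivative G'' z) (at z)"
    and G'': "continuous_on UNIV G''"
    and r: "0 < r"
    and min: "\<And>s. \<bar>s\<bar> < r \<Longrightarrow> integral (cbox a b) (\<lambda>x. w x * G (x$i))
        \<le> integral (cbox a b) (\<lambda>x. w x * G (x$i - s)) - k * (2 * \<beta> * s + s\<^sup>2)"
  shows "2 * k \<le> integral (cbox a b) (\<lambda>x. w x * G'' (x$i))"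
proof -
  have contG': "continuous_on UNIV G'"
    using G' by (meson DERIV_continuous_on DERIV_subset top_greatest)
  let ?F = "\<lambda>s. integral (cbox a b) (\<lambda>x. w x * G (x$i - s)) - k * (2 * \<beta> * s + s\<^sup>2)"
  let ?F' = "\<lambda>s. integral (cbox a b) (\<lambda>x. w x * - G' (x$i - s)) - k * (2 * \<beta> + 2 * s)"
  have 1: "(?F has_real_derivative ?F' s) (at s)" for s
    by (rule DERIV_diff[OF convolution_has_real_derivative[OF w G contG']])
       (auto intro!: derivative_eq_intros)
  have "((\<lambda>s. integral (cbox a b) (\<lambda>x. w x * (- G' (x$i - s)))) has_real_derivative
           integral (cbox a b) (\<lambda>x. w x * - (- G'' (x$i - 0)))) (at 0)"
    by (rule convolution_has_real_derivative[OF w, of "\<lambda>z. - G' z"])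
       (auto intro!: DERIV_minus G' continuous_intros G'')
  then have 2: "(?F' has_real_derivative
           integral (cbox a b) (\<lambda>x. w x * G'' (x$i)) - k * 2) (at 0)"
    by (intro DERIV_diff) (auto intro!: derivative_eq_intros)
  have "0 \<le> integral (cbox a b) (\<lambda>x. w x * G'' (x$i)) - k * 2"
    by (rule second_derivative_test_min[OF 1 2 r]) (use min in auto)
  then show ?thesis by simp
qed

section \<open>Mollification by square bumps\<close>

lemma norm_sq_2: "(norm (x::real^2))\<^sup>2 = (x$1)\<^sup>2 + (x$2)\<^sup>2"
  by (simp add: norm_vec_def L2_set_def sum_2)

text \<open>
  The constant \<open>4 * k\<close> is the Laplacian of \<open>k|x - c|\<^sup>2\<close>. Since the bump is even, the mollification
  \<open>M\<close> is differentiated by shifting the centre \<open>y\<close> of the bump.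
\<close>

lemma mollification_at_min:
  fixes u :: "real^2 \<Rightarrow> real" and a b c y :: "real^2" and e k r :: real
  defines "M \<equiv> \<lambda>y. integral (cbox a b) (\<lambda>x. u x * square_bump y e x)"
  assumes u: "continuous_on UNIV u" and r: "0 < r"
    and min: "\<And>y'. y' \<in> ball y r \<Longrightarrow>
      M y - k * (norm (y - c))\<^sup>2 \<le> M y' - k * (norm (y' - c))\<^sup>2"
  shows "4 * k \<le> integral (cbox a b) (\<lambda>x. u x * square_bump_lap y e x)"
proof -
  note d = bump_scaled_has_real_derivative
  \<comment> \<open>The bump in the coordinate that stays fixed is absorbed into the weight, which
    leaves a one-dimensional convolution in the other.\<close>
  let ?w1 = "\<lambda>x. u x * bump ((x$2 - y$2) / e)" and ?w2 = "\<lambda>x. u x * bump ((x$1 - y$1) / e)"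
  let ?G = "\<lambda>i z. bump ((z - y$i) / e)"
  let ?G'' = "\<lambda>i z. bump'' ((z - y$i) / e) / e\<^sup>2"
  have w: "continuous_on UNIV ?w1" "continuous_on UNIV ?w2"
    and G'': "continuous_on UNIV (?G'' i)" for i
    using u by (auto simp: divide_inverse intro!: continuous_intros)
  have in_ball: "y + axis i s \<in> ball y r" if "\<bar>s\<bar> < r" for s and i :: 2
    using that by (simp add: dist_norm norm_eq_sqrt_inner inner_axis_axis)
  have "2 * k \<le> integral (cbox a b) (\<lambda>x. ?w1 x * ?G'' 1 (x$1))"
  proof (rule convolution_second_derivative_test[OF w(1) d(1)[of "y$1" e] d(2)[of "y$1" e] G'' r])
    fix s :: real assume "\<bar>s\<bar> < r"
    from min[OF in_ball[OF this, of 1]]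
    show "integral (cbox a b) (\<lambda>x. ?w1 x * ?G 1 (x$1))
       \<le> integral (cbox a b) (\<lambda>x. ?w1 x * ?G 1 (x$1 - s)) - k * (2 * (y$1 - c$1) * s + s\<^sup>2)"
      unfolding M_def square_bump_def norm_sq_2
      by (simp add: axis_def algebra_simps power2_eq_square)
  qed
  moreover have "2 * k \<le> integral (cbox a b) (\<lambda>x. ?w2 x * ?G'' 2 (x$2))"
  proof (rule convolution_second_derivative_test[OF w(2) d(1)[of "y$2" e] d(2)[of "y$2" e] G'' r])
    fix s :: real assume "\<bar>s\<bar> < r"
    from min[OF in_ball[OF this, of 2]]
    show "integral (cbox a b) (\<lambda>x. ?w2 x * ?G 2 (x$2))
       \<le> integral (cbox a b) (\<lambda>x. ?w2 x * ?G 2 (x$2 - s)) - k * (2 * (y$2 - c$2) * s + s\<^sup>2)"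
      unfolding M_def square_bump_def norm_sq_2
      by (simp add: axis_def algebra_simps power2_eq_square)
  qed
  moreover have "integral (cbox a b) (\<lambda>x. u x * square_bump_lap y e x) =
      integral (cbox a b) (\<lambda>x. ?w1 x * ?G'' 1 (x$1)) + integral (cbox a b) (\<lambda>x. ?w2 x * ?G'' 2 (x$2))"
  proof (subst integral_add[symmetric])
    show "(\<lambda>x. ?w1 x * ?G'' 1 (x$1)) integrable_on cbox a b"
      "(\<lambda>x. ?w2 x * ?G'' 2 (x$2)) integrable_on cbox a b"
      using u by (auto simp: divide_inverse intro!: integrable_continuous continuous_intros
          intro: continuous_on_subset)
  qed (simp add: square_bump_lap_def add_divide_distrib algebra_simps)
  ultimately show ?thesis by simp
qed

text \<open>By translation invariance the mass does not depend on the centre, so one constant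
  \<open>Z\<close> serves for all \<open>y\<close> in the mollification.\<close>

lemma integral_square_bump:
  assumes e: "0 < e" and sub: "square y e \<subseteq> cbox a b"
  shows "integral (cbox a b) (square_bump y e) = integral (square 0 e) (square_bump 0 e)"
proof -
  have "square_bump y e integrable_on cbox (y - vec e) (y + vec e)"
    by (intro integrable_continuous continuous_on_square_bump[of _ "\<lambda>x. x", simplified])
  then obtain I where I: "(square_bump y e has_integral I) (cbox (y - vec e) (y + vec e))"
    by (auto simp: integrable_on_def)
  have "(square_bump y e has_integral I) (cbox a b)"
    using has_integral_on_superset[OF I] sub square_bump_eq_0(1)[OF e] by (auto simp: square_def)
  moreover have "(square_bump 0 e has_integral I) (square 0 e)"
    using has_integral_shift_cbox[OF I, of y] by (simp add: square_bump_def[abs_def] square_def)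
  ultimately show ?thesis by (simp add: integral_unique)
qed

lemma integral_square_bump_pos:
  assumes e: "0 < e" shows "0 < integral (square 0 e) (square_bump 0 e)"
proof -
  have cont: "continuous_on (square 0 e) (square_bump 0 e)"
    by (intro continuous_on_square_bump[of _ "\<lambda>x. x", simplified])
  have "box (0 - vec e) (0 + vec e :: real^2) \<noteq> {}"
    using e by (auto simp: box_ne_empty inner_axis Basis_vec_def algebra_simps)
  moreover have "square_bump 0 e 0 > 0" "0 \<in> square 0 e"
    using square_bump_pos[OF e] e by (auto simp: mem_square_iff)
  ultimately have "integral (square 0 e) (square_bump 0 e) \<noteq> 0"
    using cont integral_cbox_eq_0_iff[of "0 - vec e" "0 + vec e" "square_bump 0 e"]
    by (force simp: square_def square_bump_nonneg)
  moreover have "0 \<le> integral (square 0 e) (square_bump 0 e)"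
    using cont unfolding square_def
    by (intro integral_nonneg integrable_continuous) (auto simp: square_bump_nonneg)
  ultimately show ?thesis by simp
qed

lemma dist_le_square: "x \<in> square y e \<Longrightarrow> dist y x \<le> 2 * e"
  using norm_le_l1_cart[of "y - x"]
  by (auto simp: mem_square_iff dist_norm sum_2 abs_minus_commute[of "y$_"])

text \<open>The kernel is nonnegative but not normalised: its mass is \<open>Z\<close>, so the
  mollification approximates \<open>Z * u y\<close>.\<close>

lemma mollification_close:
  fixes u :: "real^2 \<Rightarrow> real" and a b y :: "real^2" and e g :: real
  assumes u: "continuous_on UNIV u" and e: "0 < e" and sub: "square y e \<subseteq> cbox a b"
    and close: "\<And>x. x \<in> square y e \<Longrightarrow> \<bar>u x - u y\<bar> \<le> g"
  defines "Z \<equiv> integral (square 0 e) (square_bump 0 e)"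
  shows "\<bar>integral (cbox a b) (\<lambda>x. u x * square_bump y e x) - Z * u y\<bar> \<le> g * Z"
proof -
  have Z: "Z = integral (cbox a b) (square_bump y e)"
    unfolding Z_def integral_square_bump[OF e sub] ..
  have I: "square_bump y e integrable_on cbox a b"
    by (intro integrable_continuous continuous_on_square_bump[of _ "\<lambda>x. x", simplified])
  have uI: "(\<lambda>x. u x * square_bump y e x) integrable_on cbox a b"
    by (intro integrable_continuous continuous_intros continuous_on_subset[OF u]) auto
  have "integral (cbox a b) (\<lambda>x. u x * square_bump y e x) - Z * u y
      = integral (cbox a b) (\<lambda>x. u x * square_bump y e x - u y * square_bump y e x)"
    using uI I by (simp add: Z Henstock_Kurzweil_Integration.integral_diff integrable_on_mult_right)
  also have "norm \<dots> \<le> integral (cbox a b) (\<lambda>x. g * square_bump y e x)"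
  proof (rule integral_norm_bound_integral)
    fix x
    show "norm (u x * square_bump y e x - u y * square_bump y e x) \<le> g * square_bump y e x"
    proof (cases "x \<in> square y e")
      case True
      then show ?thesis
        using close[OF True] square_bump_nonneg[of y e x]
        by (simp add: abs_mult mult_right_mono flip: left_diff_distrib)
    qed (simp add: square_bump_eq_0 e)
  qed (use uI I in \<open>auto intro!: integrable_diff integrable_on_mult_right\<close>)
  also have "\<dots> = g * Z" by (simp add: Z)
  finally show ?thesis by simp
qed

text \<open>The minimum principle is applied to the mollification of \<open>u\<close> minus a
  paraboloid. At an interior minimum the Laplacian of the mollification is at least
  \<open>4 * Z * k\<close>, whereas the weak equation bounds it by \<open>lam * m * Z\<close>, which
  is smaller. The bound \<open>lam * t\<^sup>2 \<le> 4\<close> keeps the paraboloid small enough on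
  the circle.\<close>

lemma weak_solution_circle_not_pos:
  assumes wu: "weak_solution lam u" and t: "0 < t" "lam * t\<^sup>2 \<le> 4"
    and V: "\<And>x. x \<in> cball c t \<Longrightarrow> (norm x)\<^sup>2 \<le> lam" and uc: "u c \<le> 0"
  shows "\<not> (\<forall>x\<in>sphere c t. 0 < u x)"
proof
  assume pos: "\<forall>x\<in>sphere c t. 0 < u x"
  have u: "continuous_on UNIV u" using wu by (simp add: weak_solution_def)
  have cball: "compact (cball c t)" "cball c t \<noteq> {}" using t by auto
  obtain z where z: "z \<in> cball c t" "\<And>x. x \<in> cball c t \<Longrightarrow> u z \<le> u x"
    using continuous_attains_inf[OF cball continuous_on_subset[OF u]] by auto
  define m where "m = - u z"
  have m: "0 \<le> m" using z(2)[of c] uc t by (simp add: m_def)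
  have "compact (sphere c t)" "sphere c t \<noteq> {}" using t by auto
  then obtain q where q: "q \<in> sphere c t" "\<And>x. x \<in> sphere c t \<Longrightarrow> u q \<le> u x"
    using continuous_attains_inf[OF _ _ continuous_on_subset[OF u]] by (metis subset_UNIV)
  define A where "A = u q"
  have A: "0 < A" using pos q by (simp add: A_def)
  \<comment> \<open>The surplus \<open>A / (2 t\<^sup>2)\<close> over \<open>lam * m / 4\<close> makes \<open>w\<close> strictly superharmonic while keeping it
    above its interior minimum on the circle.\<close>
  define k where "k = lam * m / 4 + A / (2 * t\<^sup>2)"
  have "0 \<le> lam" using V[of c] t by (simp add: order_trans[OF zero_le_power2])
  then have k: "0 \<le> k" using m A by (simp add: k_def)
  define w where "w x = u x - k * (norm (x - c))\<^sup>2" for x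
  have w: "continuous_on UNIV w" unfolding w_def by (intro continuous_intros u)
  have w_sphere: "A / 2 - m \<le> w x" if "x \<in> sphere c t" for x
  proof -
    have "k * t\<^sup>2 = lam * t\<^sup>2 * m / 4 + A / 2" using t by (simp add: k_def field_simps)
    also have "lam * t\<^sup>2 * m / 4 \<le> m" using t m mult_right_mono[of "lam * t\<^sup>2" 4 m] by simp
    finally show ?thesis
      using that q(2)[OF that] by (simp add: w_def A_def dist_norm norm_minus_commute)
  qed
  have wz: "w z \<le> - m" using k by (simp add: w_def m_def)
  \<comment> \<open>The larger radius leaves room for bump squares centred in the disc but reaching
    beyond it.\<close>
  have uc: "uniformly_continuous_on (cball c (t + 1)) u" "uniformly_continuous_on (cball c (t + 1)) w"
    using u w by (auto intro!: compact_uniformly_continuous intro: continuous_on_subset)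
  have A8: "0 < A / 8" using A by simp
  obtain d1 where d1: "d1 > 0" "\<And>x y. x \<in> cball c (t + 1) \<Longrightarrow> y \<in> cball c (t + 1) \<Longrightarrow>
        dist y x < d1 \<Longrightarrow> dist (u y) (u x) < A / 8"
    using uniformly_continuous_onE[OF uc(1) A8] by blast
  obtain d2 where d2: "d2 > 0" "\<And>x y. x \<in> cball c (t + 1) \<Longrightarrow> y \<in> cball c (t + 1) \<Longrightarrow>
        dist y x < d2 \<Longrightarrow> dist (w y) (w x) < A / 8"
    using uniformly_continuous_onE[OF uc(2) A8] by blast
  define d where "d = Min {d1, d2, 1}"
  have d: "0 < d" "d \<le> d1" "d \<le> d2" "d \<le> 1" using d1 d2 by (auto simp: d_def)
  \<comment> \<open>Points of a square of half-side \<open>e\<close> have distance at most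
    \<open>2 * e < d\<close> from its centre.\<close>
  define e where "e = d / 3"
  have e: "0 < e" "2 * e < d" using d by (auto simp: e_def)
  define a b where "a = c - vec (t + 1)" and "b = c + vec (t + 1)"
  define Z where "Z = integral (square 0 e) (square_bump 0 e)"
  have Z: "0 < Z" unfolding Z_def by (rule integral_square_bump_pos[OF e(1)])
  have sub: "square y e \<subseteq> cbox a b" if "y \<in> cball c t" for y
  proof
    fix x assume x: "x \<in> square y e"
    have "\<bar>y$i - c$i\<bar> \<le> t" for i
      using that component_le_norm_cart[of "y - c" i] by (simp add: dist_norm norm_minus_commute)
    moreover have "\<bar>x$i - y$i\<bar> \<le> 1" for i
      using x exhaust_2[of i] e d by (auto simp: mem_square_iff)
    ultimately show "x \<in> cbox a b"
      by (simp add: a_def b_def mem_box_cart) (smt (verit))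
  qed
  have near: "x \<in> cball c (t + 1) \<and> dist y x < d" if "y \<in> cball c t" "x \<in> square y e" for x y
    using that dist_le_square[OF that(2)] e d dist_triangle[of c x y] by auto
  define M where "M y = integral (cbox a b) (\<lambda>x. u x * square_bump y e x)" for y
  have M: "\<bar>M y - Z * u y\<bar> \<le> A / 8 * Z" if "y \<in> cball c t" for y
    unfolding M_def Z_def
  proof (rule mollification_close[OF u e(1) sub[OF that]])
    fix x assume "x \<in> square y e"
    with near[OF that this] d1(2)[of y x] that d
    show "\<bar>u x - u y\<bar> \<le> A / 8" by (auto simp: dist_real_def dist_commute)
  qed
  have contM: "continuous_on (cball c t) (\<lambda>y. M y - (Z * k) * (norm (y - c))\<^sup>2)"
    unfolding M_def
  proof (intro continuous_intros integral_continuous_on_param)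
    show "continuous_on (cball c t \<times> cbox a b) (\<lambda>(y, x). u x * square_bump y e x)"
      unfolding split_beta square_bump_def divide_inverse
      by (intro continuous_intros continuous_on_compose2[OF u]) auto
  qed
  obtain y where y: "y \<in> cball c t"
    "\<And>x. x \<in> cball c t \<Longrightarrow> M y - (Z * k) * (norm (y - c))\<^sup>2 \<le> M x - (Z * k) * (norm (x - c))\<^sup>2"
    using continuous_attains_inf[OF cball contM] by auto
  \<comment> \<open>Comparing the minimum at \<open>y\<close> with the value at \<open>z\<close>
    costs two mollification errors of \<open>A / 8 * Z\<close>.\<close>
  have "Z * w y \<le> Z * w z + Z * (A / 4)"
    using y(2)[OF z(1)] M[OF y(1)] M[OF z(1)] unfolding abs_le_iff w_def
    by (simp add: algebra_simps)
  then have "Z * w y \<le> Z * (w z + A / 4)" by (simp add: algebra_simps)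
  then have wy: "w y \<le> A / 4 - m" using Z wz by simp
  \<comment> \<open>Otherwise the ball meets the circle, where \<open>w\<close> is at least
    \<open>A / 2 - m\<close>. But \<open>w y\<close> is at most \<open>A / 4 - m\<close>, and
    \<open>w\<close> varies by less than \<open>A / 8\<close> over distances below
    \<open>d\<close>.\<close>
  have ball: "ball y d \<subseteq> cball c t"
  proof (rule ccontr)
    assume "\<not> ball y d \<subseteq> cball c t"
    moreover have "y \<in> ball y d \<inter> cball c t" using d y(1) by simp
    ultimately have "ball y d \<inter> frontier (cball c t) \<noteq> {}"
      by (intro connected_Int_frontier connected_ball) blast+
    then obtain x where "x \<in> ball y d" "x \<in> frontier (cball c t)" by blast
    then have x: "dist y x < d" "x \<in> sphere c t" using t by auto
    have "dist (w x) (w y) < A / 8"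
      using x y(1) d by (intro d2(2)) (auto simp: dist_commute)
    then show False using w_sphere[OF x(2)] wy A by (auto simp: dist_real_def)
  qed
  have "4 * (Z * k) \<le> integral (cbox a b) (\<lambda>x. u x * square_bump_lap y e x)"
    by (rule mollification_at_min[OF u d(1), where c = c])
       (use y(2) ball in \<open>auto simp: M_def subset_iff\<close>)
  \<comment> \<open>Subtracting the weak equation, whose integral is 0, cancels the Laplacian of the
    bump and leaves the zeroth-order term.\<close>
  also have "\<dots> = integral (cbox a b) (\<lambda>x. u x * square_bump_lap y e x)
      - integral (cbox a b) (\<lambda>x. u x * (square_bump_lap y e x + (lam - (norm x)\<^sup>2) * square_bump y e x))"
    using wu e(1) sub[OF y(1)] by (simp add: weak_solution_def)
  also have "\<dots> = integral (cbox a b) (\<lambda>x. u x * square_bump_lap y e x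
      - u x * (square_bump_lap y e x + (lam - (norm x)\<^sup>2) * square_bump y e x))"
    by (intro Henstock_Kurzweil_Integration.integral_diff[symmetric] integrable_continuous
        continuous_intros continuous_on_subset[OF u]) auto
  also have "\<dots> \<le> integral (cbox a b) (\<lambda>x. lam * m * square_bump y e x)"
  proof (rule integral_le)
    fix x
    show "u x * square_bump_lap y e x
      - u x * (square_bump_lap y e x + (lam - (norm x)\<^sup>2) * square_bump y e x)
      \<le> lam * m * square_bump y e x"
    proof (cases "x \<in> square y e")
      case True
      \<comment> \<open>The bump square lies in \<open>ball y d\<close>, hence in the disc, where
        \<open>u\<close> is at least \<open>-m\<close>.\<close>
      have x: "x \<in> cball c t" using near[OF y(1) True] ball by auto
      have "(- u x) * (lam - (norm x)\<^sup>2) \<le> m * (lam - (norm x)\<^sup>2)"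
        using z(2)[OF x] V[OF x] by (intro mult_right_mono) (auto simp: m_def)
      also have "\<dots> \<le> m * lam" using m by (intro mult_left_mono) auto
      finally have "(- u x) * (lam - (norm x)\<^sup>2) * square_bump y e x \<le> m * lam * square_bump y e x"
        by (intro mult_right_mono square_bump_nonneg)
      then show ?thesis by (simp add: algebra_simps)
    qed (simp add: square_bump_eq_0 e)
  qed (intro integrable_continuous continuous_intros continuous_on_subset[OF u]; simp)+
  also have "\<dots> = lam * m * Z"
    using integral_square_bump[OF e(1) sub[OF y(1)]] by (simp add: Z_def)
  finally have "Z * (4 * k) \<le> Z * (lam * m)" by (simp add: algebra_simps)
  then have "4 * k \<le> lam * m" using Z by simp
  moreover have "0 < A / t\<^sup>2" using A t by simp
  ultimately show False by (simp add: k_def)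
qed

text \<open>Since \<open>u c = 0\<close>, the preceding lemma applies to \<open>u\<close> and to
  \<open>- u\<close>; a planar circle is connected.\<close>

lemma weak_solution_circle_zero:
  assumes u: "weak_solution lam u" and t: "0 < t" "lam * t\<^sup>2 \<le> 4"
    and V: "\<And>x. x \<in> cball c t \<Longrightarrow> (norm x)\<^sup>2 \<le> lam" and uc: "u c = 0"
  obtains x where "x \<in> sphere c t" "u x = 0"
proof -
  have "connected (sphere c t)" by (rule connected_sphere) simp
  moreover have "continuous_on (sphere c t) u"
    using u by (auto simp: weak_solution_def intro: continuous_on_subset)
  moreover have "\<not> (\<forall>x\<in>sphere c t. u x < 0)"
    using weak_solution_circle_not_pos[OF weak_solution_uminus[OF u] t V] uc by simp
  moreover have "\<not> (\<forall>x\<in>sphere c t. 0 < u x)"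
    using weak_solution_circle_not_pos[OF u t V] uc by simp
  ultimately have "\<not> (\<forall>x\<in>sphere c t. u x \<noteq> 0)"
    using connected_nonzero_sign by blast
  then show thesis using that by blast
qed

section \<open>Length of separated pieces\<close>

text \<open>A 1-Lipschitz map sends each covering piece into an interval as long as its diameter,
  and these intervals cover \<open>{0<..<r}\<close>. Pieces missing \<open>A\<close> count 0, so
  that the bounds for several separated sets can be added.\<close>

lemma suminf_diameter_ge:
  fixes f :: "'a::metric_space \<Rightarrow> real" and U :: "nat \<Rightarrow> 'a set"
  assumes lip: "\<And>x y. x \<in> A \<Longrightarrow> y \<in> A \<Longrightarrow> dist (f x) (f y) \<le> dist x y"
    and range: "{0<..<r} \<subseteq> f ` A" and r: "0 \<le> r"
    and cover: "A \<subseteq> (\<Union>k. U k)" and bdd: "\<And>k. bounded (U k)"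
  shows "ennreal r \<le> (\<Sum>k. if U k \<inter> A = {} then 0 else ennreal (diameter (U k)))"
proof -
  define S where "S k = f ` (U k \<inter> A)" for k
  define J where "J k = (if U k \<inter> A = {} then {} else {Inf (S k)..Inf (S k) + diameter (U k)})" for k
  have SJ: "S k \<subseteq> J k" for k
  proof
    fix y assume y: "y \<in> S k"
    have D: "y' - diameter (U k) \<le> z" if "y' \<in> S k" "z \<in> S k" for y' z
    proof -
      obtain x x' where "x \<in> U k \<inter> A" "x' \<in> U k \<inter> A" "y' = f x" "z = f x'"
        using \<open>y' \<in> S k\<close> \<open>z \<in> S k\<close> by (auto simp: S_def)
      then show ?thesis
        using lip[of x x'] diameter_bounded_bound[OF bdd[of k], of x x'] by (auto simp: dist_real_def)
    qed
    have "bdd_below (S k)" using D[OF y] by (rule bdd_belowI)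
    then have "Inf (S k) \<le> y" using y by (intro cInf_lower)
    moreover have "y - diameter (U k) \<le> Inf (S k)" using y D[OF y] by (intro cInf_greatest) auto
    ultimately show "y \<in> J k" using y by (auto simp: J_def S_def)
  qed
  have "{0<..<r} \<subseteq> (\<Union>k. J k)"
  proof
    fix t assume "t \<in> {0<..<r}"
    then obtain x where "x \<in> A" "t = f x" using range by auto
    then obtain k where "t \<in> S k" using cover unfolding S_def by blast
    then show "t \<in> (\<Union>k. J k)" using SJ by auto
  qed
  then have "emeasure lborel {0<..<r} \<le> emeasure lborel (\<Union>k. J k)"
    by (intro emeasure_mono) (auto simp: J_def)
  also have "\<dots> \<le> (\<Sum>k. emeasure lborel (J k))"
    by (intro emeasure_subadditive_countably) (auto simp: J_def)
  also have "(\<lambda>k. emeasure lborel (J k)) = (\<lambda>k. if U k \<inter> A = {} then 0 else ennreal (diameter (U k)))"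
    using diameter_ge_0[OF bdd] by (auto simp: J_def fun_eq_iff)
  finally show ?thesis using r by simp
qed

text \<open>A covering set of diameter at most \<open>d\<close> meets at most one of the sets
  \<open>A i\<close>, so no diameter is counted twice when the lower bounds are summed.\<close>

lemma hausdorff_pre_ge_card:
  fixes f :: "'i \<Rightarrow> 'a::metric_space \<Rightarrow> real" and d r :: real
  assumes fin: "finite I"
    and sub: "\<And>i. i \<in> I \<Longrightarrow> A i \<subseteq> B"
    and sep: "\<And>i j x y. i \<in> I \<Longrightarrow> j \<in> I \<Longrightarrow> i \<noteq> j \<Longrightarrow> x \<in> A i \<Longrightarrow> y \<in> A j \<Longrightarrow> d < dist x y"
    and lip: "\<And>i x y. i \<in> I \<Longrightarrow> x \<in> A i \<Longrightarrow> y \<in> A i \<Longrightarrow> dist (f i x) (f i y) \<le> dist x y"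
    and range: "\<And>i. i \<in> I \<Longrightarrow> {0<..<r} \<subseteq> f i ` A i" and r: "0 \<le> r"
  shows "ennreal (card I * r) \<le> hausdorff_pre d B"
  unfolding hausdorff_pre_def
proof (rule INF_greatest)
  fix U :: "nat \<Rightarrow> 'a set"
  assume "U \<in> {U. B \<subseteq> (\<Union>k. U k) \<and> (\<forall>k. bounded (U k) \<and> diameter (U k) \<le> d)}"
  then have cover: "B \<subseteq> (\<Union>k. U k)" and bdd: "\<And>k. bounded (U k)" and diam: "\<And>k. diameter (U k) \<le> d"
    by auto
  let ?c = "\<lambda>i k. if U k \<inter> A i = {} then 0 else ennreal (diameter (U k))"
  have "ennreal (card I * r) = (\<Sum>i\<in>I. ennreal r)"
    using r by (simp add: ennreal_mult ennreal_of_nat_eq_real_of_nat)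
  also have "\<dots> \<le> (\<Sum>i\<in>I. \<Sum>k. ?c i k)"
  proof (rule sum_mono)
    fix i assume i: "i \<in> I"
    show "ennreal r \<le> (\<Sum>k. ?c i k)"
      by (rule suminf_diameter_ge[OF lip[OF i] range[OF i] r _ bdd]) (use sub[OF i] cover in auto)
  qed
  also have "\<dots> = (\<Sum>k. \<Sum>i\<in>I. ?c i k)"
    by (rule suminf_sum[symmetric]) simp
  also have "\<dots> \<le> (\<Sum>k. ennreal (diameter (U k)))"
  proof (rule suminf_le)
    fix k
    show "(\<Sum>i\<in>I. ?c i k) \<le> ennreal (diameter (U k))"
    proof (cases "\<exists>i\<in>I. U k \<inter> A i \<noteq> {}")
      case True
      then obtain i x where i: "i \<in> I" "x \<in> U k" "x \<in> A i" by auto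
      have "U k \<inter> A j = {}" if "j \<in> I" "j \<noteq> i" for j
      proof (rule ccontr)
        assume "U k \<inter> A j \<noteq> {}"
        then obtain y where y: "y \<in> U k" "y \<in> A j" by auto
        have "d < dist x y" using sep[OF i(1) that(1)] that(2) i(3) y(2) by auto
        then show False
          using diameter_bounded_bound[OF bdd i(2) y(1)] diam[of k] by simp
      qed
      then have "(\<Sum>i\<in>I. ?c i k) = (\<Sum>j\<in>I. if j = i then ennreal (diameter (U k)) else 0)"
        using i by (intro sum.cong) auto
      then show ?thesis using fin i(1) by simp
    qed simp
  qed auto
  finally show "ennreal (card I * r) \<le> (\<Sum>k. ennreal (diameter (U k)))" .
qed

section \<open>Counting zeros on a grid\<close>

lemma norm_less_of_coordinates:
  fixes x :: "real^2"
  assumes "\<bar>x$1\<bar> < R / 2" "\<bar>x$2\<bar> < R / 2"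
  shows "norm x < R"
  using norm_le_l1_cart[of x] assms by (simp add: sum_2)

lemma grid_separation:
  fixes i j :: nat and x y L h :: real
  assumes "i \<noteq> j" "\<bar>x - i * L\<bar> < h" "\<bar>y - j * L\<bar> < h" "0 \<le> L"
  shows "L - 2 * h < \<bar>x - y\<bar>"
proof -
  have "1 \<le> \<bar>real i - real j\<bar>" using assms(1) by (cases i j rule: linorder_cases) auto
  then have "1 * L \<le> \<bar>real i - real j\<bar> * L" using assms(4) by (intro mult_right_mono)
  also have "\<dots> = \<bar>i * L - j * L\<bar>" using assms(4) by (simp add: abs_mult flip: left_diff_distrib)
  finally show ?thesis using assms(2,3) by linarith
qed

theorem theorem1p7:
  fixes \<delta> :: real
  assumes "0 < \<delta>" and "\<delta> < 1"
  shows "\<exists>C>0. \<exists>\<Lambda>. \<forall>lam\<ge>\<Lambda>. \<forall>u. oscillator_eigenfunction lam u \<longrightarrow>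
           ennreal (C * lam powr (3/2)) \<le>
             hausdorff_length (nodal_set u \<inter> ball 0 (sqrt (\<delta> * lam)))"
proof -
  \<comment> \<open>With \<open>s = k * r\<close> this gives
    \<open>18 / s\<^sup>2 = 18 / 20 * ((1 - \<delta>) * lam)\<close>, below the potential term; 20
    is an arbitrary number above 18.\<close>
  define k where "k = sqrt (20 / (1 - \<delta>))"
  have k: "0 < k" "k\<^sup>2 = 20 / (1 - \<delta>)" using assms by (auto simp: k_def)
  \<comment> \<open>The grid spacing becomes \<open>L = 2 * s + 4 * r\<close>, so the discs at
    different grid points are more than \<open>L - 2 * (s + r) = 2 * r\<close> apart in some
    coordinate.\<close>
  define b where "b = 2 * k + 4"
  have b: "0 < b" using k by (simp add: b_def)
  \<comment> \<open>There are \<open>m\<^sup>2\<close> grid points with \<open>m\<close> at least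
    \<open>X / 2\<close>, and \<open>(X / 2)\<^sup>2 = C * lam\<^sup>2\<close>.\<close>
  define C where "C = \<delta> / (16 * b\<^sup>2)"
  \<comment> \<open>Ensures \<open>X \<ge> 2\<close>, so that rounding \<open>X\<close> down loses
    at most half.\<close>
  define \<Lambda> where "\<Lambda> = 4 * b / sqrt \<delta>"
  have C: "0 < C" and \<Lambda>: "0 < \<Lambda>" using assms b by (auto simp: C_def \<Lambda>_def)
  have "ennreal (C * lam powr (3/2)) \<le> hausdorff_length (nodal_set u \<inter> ball 0 (sqrt (\<delta> * lam)))"
    if lam: "\<Lambda> \<le> lam" and eig: "oscillator_eigenfunction lam u" for lam u
  proof -
    have u: "weak_solution lam u" by (rule weak_solution_eigenfunction[OF eig])
    have lam0: "0 < lam" using lam \<Lambda> by simp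
    define r where "r = 1 / sqrt lam"
    define s where "s = k * r"
    define L where "L = b * r"
    have r: "0 < r" "lam * r\<^sup>2 = 1" using lam0 by (auto simp: r_def power_divide)
    have s: "0 < s" using k r by (simp add: s_def)
    have L: "L = 2 * s + 4 * r" "0 < L"
      using r b by (simp add: L_def b_def s_def algebra_simps) (simp add: L_def b r)
    define R where "R = sqrt (\<delta> * lam)"
    define X where "X = R / (2 * L)"
    have X: "X = sqrt \<delta> * lam / (2 * b)"
      using lam0 by (simp add: X_def R_def L_def r_def real_sqrt_mult)
    have "2 \<le> X"
      using lam assms b by (simp add: X \<Lambda>_def field_simps)
    define m where "m = nat \<lfloor>X\<rfloor>"
    have m: "real m \<le> X" "X / 2 \<le> real m" using \<open>2 \<le> X\<close> by (auto simp: m_def) linarith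
    have mL: "m * L \<le> R / 2" using m(1) L by (simp add: X_def field_simps)
    define I where "I = {..<m} \<times> {..<m}"
    define p :: "nat \<times> nat \<Rightarrow> real^2" where "p = (\<lambda>(i, j). vector [i * L, j * L])"
    have p: "p ij $ 1 = real (fst ij) * L" "p ij $ 2 = real (snd ij) * L" for ij
      by (auto simp: p_def split_beta)
    have inside: "norm x < R" if "ij \<in> I" "\<bar>x$1 - p ij$1\<bar> < s + r" "\<bar>x$2 - p ij$2\<bar> < s + r" for ij and x :: "real^2"
    proof -
      have *: "\<bar>z\<bar> < R / 2" if "i < m" "\<bar>z - i * L\<bar> < s + r" for i :: nat and z :: real
      proof -
        \<comment> \<open>As \<open>i < m\<close>, a full spacing \<open>L > s + r\<close> is left
          before \<open>R / 2\<close>; on the other side of 0 the overhang \<open>s + r\<close> is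
          below \<open>R / 2\<close> as well.\<close>
        have "(real i + 1) * L \<le> m * L" using that(1) L(2) by (intro mult_right_mono) auto
        then have "real i * L + L \<le> R / 2" using mL by (simp add: distrib_right)
        moreover have "0 \<le> real i * L" using L(2) by simp
        ultimately show ?thesis using that(2) L(1) s r(1) by linarith
      qed
      show ?thesis
        using that by (intro norm_less_of_coordinates *[of "fst ij"] *[of "snd ij"]) (auto simp: I_def p)
    qed
    have "\<exists>c. c \<in> square (p ij) s \<and> u c = 0" if ij: "ij \<in> I" for ij
    proof -
      have "18 / s\<^sup>2 < lam - (norm x)\<^sup>2" if "x \<in> square (p ij) s" for x
      proof -
        have "norm x < R" using that r by (intro inside[OF ij]) (auto simp: mem_square_iff)
        then have "(norm x)\<^sup>2 < R\<^sup>2" by (intro power_strict_mono) auto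
        then have "(1 - \<delta>) * lam < lam - (norm x)\<^sup>2"
          using assms lam0 by (simp add: R_def algebra_simps)
        moreover have "18 / s\<^sup>2 = 18 / 20 * ((1 - \<delta>) * lam)"
          using k lam0 assms by (simp add: s_def power_mult_distrib r_def power_divide)
        moreover have "0 < (1 - \<delta>) * lam" using assms lam0 by simp
        ultimately show ?thesis by linarith
      qed
      then show ?thesis using weak_solution_zero_in_square[OF u s] by metis
    qed
    then obtain c where c: "\<And>ij. ij \<in> I \<Longrightarrow> c ij \<in> square (p ij) s" "\<And>ij. ij \<in> I \<Longrightarrow> u (c ij) = 0"
      by metis
    define A where "A ij = {x. u x = 0} \<inter> ball (c ij) r" for ij
    have near: "\<bar>x$1 - p ij$1\<bar> < s + r \<and> \<bar>x$2 - p ij$2\<bar> < s + r"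
      if "ij \<in> I" "x \<in> ball (c ij) r" for ij x
      using c(1)[OF that(1)] that(2) component_le_norm_cart[of "x - c ij" 1]
        component_le_norm_cart[of "x - c ij" 2]
      by (auto simp: mem_square_iff dist_norm norm_minus_commute)
    \<comment> \<open>The single scale \<open>d = r\<close> suffices, because the Hausdorff length
      is a supremum over scales. Distances from the zeros \<open>c ij\<close> serve as the Lipschitz
      maps.\<close>
    have "ennreal (card I * r) \<le> hausdorff_pre r (nodal_set u \<inter> ball 0 R)"
    proof (rule hausdorff_pre_ge_card[where A = A and f = "\<lambda>ij. dist (c ij)"])
      show "finite I" by (simp add: I_def)
      fix ij assume ij: "ij \<in> I"
      show "A ij \<subseteq> nodal_set u \<inter> ball 0 R"
        using inside[OF ij] near[OF ij] closure_subset[of "{x. u x = 0}"]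
        by (auto simp: A_def nodal_set_def)
      show "dist (dist (c ij) x) (dist (c ij) y) \<le> dist x y" for x y
        using dist_triangle3[of "c ij"] by (smt (verit) dist_commute dist_real_def dist_triangle)
      show "{0<..<r} \<subseteq> dist (c ij) ` A ij"
      proof
        fix t assume t: "t \<in> {0<..<r}"
        have "lam * t\<^sup>2 \<le> lam * r\<^sup>2"
          using t lam0 by (intro mult_left_mono power_mono) auto
        moreover have "(norm x)\<^sup>2 \<le> lam" if "x \<in> cball (c ij) t" for x
        proof -
          have "norm x < R" using that t inside[OF ij] near[OF ij, of x] by auto
          then have "(norm x)\<^sup>2 \<le> R\<^sup>2" by (intro power_mono) auto
          also have "\<dots> \<le> lam" using assms lam0 by (simp add: R_def)
          finally show ?thesis .
        qed
        ultimately obtain x where "x \<in> sphere (c ij) t" "u x = 0"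
          using weak_solution_circle_zero[OF u, of t "c ij"] t r c(2)[OF ij] by auto
        then show "t \<in> dist (c ij) ` A ij" using t by (auto simp: A_def)
      qed
      fix ij' x y assume ij': "ij' \<in> I" "ij \<noteq> ij'" and xy: "x \<in> A ij" "y \<in> A ij'"
      note n = near[OF ij, of x] near[OF ij'(1), of y]
      have "L - 2 * (s + r) < \<bar>(x - y)$1\<bar> \<or> L - 2 * (s + r) < \<bar>(x - y)$2\<bar>"
        using ij'(2) xy n L(2)
          grid_separation[of "fst ij" "fst ij'" "x$1" L "s + r" "y$1"]
          grid_separation[of "snd ij" "snd ij'" "x$2" L "s + r" "y$2"]
        by (auto simp: A_def p prod_eq_iff)
      then show "r < dist x y"
        using component_le_norm_cart[of "x - y" 1] component_le_norm_cart[of "x - y" 2] L r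
        by (auto simp: dist_norm)
    qed (use r in auto)
    also have "\<dots> \<le> hausdorff_length (nodal_set u \<inter> ball 0 R)"
      unfolding hausdorff_length_def using r by (intro SUP_upper) auto
    finally have *: "ennreal (card I * r) \<le> hausdorff_length (nodal_set u \<inter> ball 0 R)" .
    have "lam powr (3/2) = lam\<^sup>2 * r"
    proof -
      have "lam powr (3/2) = lam powr 2 * lam powr (- (1/2))" by (simp flip: powr_add)
      then show ?thesis
        using lam0 by (simp add: r_def powr_minus powr_half_sqrt inverse_eq_divide)
    qed
    then have "C * lam powr (3/2) = (X / 2)\<^sup>2 * r"
      using assms by (simp add: C_def X power_divide power_mult_distrib)
    also have "\<dots> \<le> (real m)\<^sup>2 * r"
      using m \<open>2 \<le> X\<close> r by (intro mult_right_mono power_mono) auto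
    also have "\<dots> = card I * r" by (simp add: I_def power2_eq_square)
    finally show ?thesis
      using * unfolding R_def by (meson ennreal_leI order_trans)
  qed
  then show ?thesis using C by blast
qed

end
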